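(* There exists an open dense set $U\subseteq\omega^\omega\times\omega^\omega$ such that $[T]\times[T]\not\subseteq U\cup\Delta$ for every Miller tree $T\subseteq\omega^{<\omega}$, where $\Delta=\{(x,x):x\in\omega^\omega\}$.
   Context: $\omega^\omega$ is the Baire space with its usual topology, and $\omega^{<\omega}=\bigcup_{n\in\omega}\omega^n$. A tree is a nonempty set $T\subseteq\omega^{<\omega}$ closed under initial segments. Its body is $[T]=\{x\in\omega^\omega:(\forall n)\ x\restriction n\in T\}$. Let $\omega\text{-}\mathrm{split}(T)=\{\sigma\in T:\{a\in\omega:\sigma^\frown a\in T\}\text{ is infinite}\}$. A tree $T$ is a Miller (superperfect) tree if for every $\sigma\in T$ there is $\tau\in\omega\text{-}\mathrm{split}(T)$ with $\sigma\subseteq\tau$. *)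

theory Defs
  imports "HOL-Analysis.Analysis" "HOL-Library.Sublist"
begin

text \<open>
  The Baire space is the type \<^typ>\<open>nat \<Rightarrow> nat\<close> with the library's type-class topology
  (the product of discrete copies of \<^typ>\<open>nat\<close>); finite sequences of naturals are lists.
\<close>

type_synonym baire = "nat \<Rightarrow> nat"

definition is_tree :: "nat list set \<Rightarrow> bool" where
  "is_tree T \<longleftrightarrow> T \<noteq> {} \<and> (\<forall>\<tau>\<in>T. \<forall>\<sigma>. prefix \<sigma> \<tau> \<longrightarrow> \<sigma> \<in> T)"

definition restrict_seq :: "baire \<Rightarrow> nat \<Rightarrow> nat list" where
  "restrict_seq x n = map x [0..<n]"

definition body :: "nat list set \<Rightarrow> baire set" where
  "body T = {x. \<forall>n. restrict_seq x n \<in> T}"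

definition omega_split :: "nat list set \<Rightarrow> nat list set" where
  "omega_split T = {\<sigma> \<in> T. infinite {a. \<sigma> @ [a] \<in> T}}"

definition miller_tree :: "nat list set \<Rightarrow> bool" where
  "miller_tree T \<longleftrightarrow> is_tree T \<and> (\<forall>\<sigma>\<in>T. \<exists>\<tau>\<in>omega_split T. prefix \<sigma> \<tau>)"

end

theory Submission
  imports Defs
begin

text \<open>
  Call $(x,y)$ \<^emph>\<open>stalled\<close> if there are $m$ and $L$ such that $x$ and $y$ have split by
  position $m$, the values of $y$ up to position $m$ are bounded by $L$, and the values of $x$ up
  to position $L$ are bounded by $m$: using the largest value seen so far of one sequence as the
  position up to which to read the other does not lead beyond $m$ and $L$. The set $U$ of stalled
  pairs is open, as finitely many coordinates witness membership. It is dense, since any two finite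
  sequences extend to distinct eventually constant, in particular bounded, infinite ones.

  In a Miller tree there are nevertheless two branches $x \neq y$ that are not stalled
  (lemma \<open>miller_tree_not_stalled_pair\<close>). They grow alternately from a common splitting
  node. When a splitting node $v$ of $y$ has been reached, the value that $x$ takes at its current
  splitting node is chosen to be at least the length of $v$, and then $x$ runs on to its next
  splitting node $u$; next, the value that $y$ takes at $v$ is chosen to be at least the length of
  $u$, and $y$ runs on to its next splitting node. The tree may make the stretches between splitting
  nodes arbitrarily long, but the position at which one branch stops is known when the next value
  of the other is chosen. So the bounds never stop growing
  (lemma \<open>interleaved_not_stalled\<close>): the value of $y$ at a splitting node points to the next
  splitting node of $x$ or beyond, and the value of $x$ there points to the next splitting node of
  $y$ or beyond.
\<close>

section \<open>The open dense set of stalled pairs\<close>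

definition stalled :: "(baire \<times> baire) set" where
  "stalled = {(x, y). \<exists>n. x n \<noteq> y n \<and>
    (\<exists>m\<ge>n. \<exists>L. (\<forall>j\<le>m. y j \<le> L) \<and> (\<forall>k\<le>L. x k \<le> m))}"

lemma continuous_on_pair_coordinates:
  shows "continuous_on UNIV (\<lambda>z :: baire \<times> baire. fst z k)"
    and "continuous_on UNIV (\<lambda>z :: baire \<times> baire. snd z k)"
proof -
  have coord: "continuous_on UNIV (\<lambda>x :: baire. x k)"
    by (rule continuous_on_product_coordinates)
  show "continuous_on UNIV (\<lambda>z :: baire \<times> baire. fst z k)"
    by (rule continuous_on_compose2[OF coord continuous_on_fst[OF continuous_on_id]]) simp
  show "continuous_on UNIV (\<lambda>z :: baire \<times> baire. snd z k)"
    by (rule continuous_on_compose2[OF coord continuous_on_snd[OF continuous_on_id]]) simp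
qed

lemma open_nat_valued_preimage:
  fixes f :: "'a :: topological_space \<Rightarrow> nat"
  assumes "continuous_on UNIV f"
  shows "open {z. P (f z)}"
  using open_vimage[OF open_discrete[of "{a. P a}"] assms] by (simp add: vimage_def)

text \<open>
  The bound $L$ in the definition of \<^const>\<open>stalled\<close> is what makes openness evident: once
  the parameters are given, only finitely many coordinates are constrained.
\<close>

lemma open_stalled: "open stalled"
proof -
  have "stalled = (\<Union>n. \<Union>m\<in>{n..}. \<Union>L. {z. fst z n \<noteq> snd z n} \<inter>
      ((\<Inter>j\<in>{..m}. {z. snd z j \<le> L}) \<inter> (\<Inter>k\<in>{..L}. {z. fst z k \<le> m})))"
    by (simp add: stalled_def set_eq_iff Bex_def, simp add: Ball_def)
  moreover have "open \<dots>"
    by (intro open_UN open_Int open_INT ballI finite_atMost open_Collect_neq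
        open_nat_valued_preimage continuous_on_pair_coordinates)
  ultimately show ?thesis by (simp only:)
qed

lemma tendsto_overwrite_tail:
  fixes x :: baire
  shows "(\<lambda>N i. if i < N then x i else c) \<longlonglongrightarrow> x"
proof -
  have "(\<lambda>N. if i < N then x i else c) \<longlonglongrightarrow> x i" for i
    by (rule tendsto_eventually, rule eventually_sequentiallyI[of "Suc i"]) simp
  then have "limitin (product_topology (\<lambda>_. euclidean) UNIV)
      (\<lambda>N i. if i < N then x i else c) x sequentially"
    by (simp add: limitin_componentwise)
  then show ?thesis
    by (simp add: euclidean_product_topology)
qed

lemma closure_stalled: "closure stalled = UNIV"
proof -
  have "(x, y) \<in> closure stalled" for x y
  proof -
    define f where "f N = (\<lambda>i. if i < N then x i else 0)" for N
    define g where "g N = (\<lambda>i. if i < N then y i else 1)" for N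
    have "(f N, g N) \<in> stalled" for N
    proof -
      have sum_bound: "w k \<le> (\<Sum>i<N. w i)" if "k < N" for w :: baire and k
        using that by (intro member_le_sum) auto
      define m where "m = N + (\<Sum>i<N. x i)"
      define L where "L = 1 + (\<Sum>i<N. y i)"
      have "N \<le> m" by (simp add: m_def)
      \<comment> \<open>The two constants 0 and 1 differ, so the sequences have split by position \<open>N\<close>.\<close>
      moreover have "f N N \<noteq> g N N" by (simp add: f_def g_def)
      moreover have "g N j \<le> L" for j
        using sum_bound[of j y] by (auto simp: g_def L_def le_SucI)
      moreover have "f N k \<le> m" for k
        using sum_bound[of k x] by (auto simp: f_def m_def trans_le_add2)
      ultimately show ?thesis unfolding stalled_def by blast
    qed
    moreover have "(\<lambda>N. (f N, g N)) \<longlonglongrightarrow> (x, y)"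
      unfolding f_def g_def by (intro tendsto_Pair tendsto_overwrite_tail)
    ultimately show ?thesis
      unfolding closure_sequential by (intro exI[of _ "\<lambda>N. (f N, g N)"]) simp
  qed
  then show ?thesis by auto
qed

section \<open>Branches along chains of nodes\<close>

lemma branch_through_chain:
  assumes tree: "is_tree T" and mem: "\<And>i. w i \<in> T"
    and chain: "\<And>i. strict_prefix (w i) (w (Suc i))"
  obtains x where "x \<in> body T" and "\<And>i k. k < length (w i) \<Longrightarrow> x k = w i ! k"
proof -
  have mono: "prefix (w i) (w j)" if "i \<le> j" for i j
    by (rule prefix_order.lift_Suc_mono_le[of w, OF prefix_order.less_imp_le[OF chain] that])
  have len: "i \<le> length (w i)" for i
  proof (induction i)
    case (Suc i)
    then show ?case using prefix_length_less[OF chain[of i]] by simp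
  qed simp
  define x where "x k = w (Suc k) ! k" for k
  have nth: "x k = w i ! k" if "k < length (w i)" for i k
  proof -
    have "k < length (w (Suc k))" using len[of "Suc k"] by simp
    moreover have "prefix (w i) (w (Suc k)) \<or> prefix (w (Suc k)) (w i)"
      using mono[of i "Suc k"] mono[of "Suc k" i] by linarith
    ultimately show ?thesis
      using that by (elim disjE) (auto simp: x_def prefix_def nth_append)
  qed
  have "restrict_seq x n \<in> T" for n
  proof -
    have "restrict_seq x n = take n (w n)"
      using len[of n] nth[of _ n] by (intro nth_equalityI) (auto simp: restrict_seq_def)
    moreover have "prefix (take n (w n)) (w n)" by (rule take_is_prefix)
    ultimately show ?thesis
      using tree mem[of n] by (simp add: is_tree_def)
  qed
  then have "x \<in> body T" by (simp add: body_def)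
  then show thesis using nth by (rule that)
qed

lemma prefix_append_nthD:
  assumes "prefix (u @ [a]) u'"
  shows "length u < length u'" and "u' ! length u = a" and "strict_prefix u u'"
  using assms by (auto simp: prefix_def strict_prefix_def nth_append)

section \<open>Interleaved branches of a Miller tree\<close>

lemma omega_split_extend:
  assumes "miller_tree T" and "s \<in> omega_split T"
  shows "\<exists>a\<ge>c. \<exists>t\<in>omega_split T. prefix (s @ [a]) t"
proof -
  have "infinite {a. s @ [a] \<in> T}" using assms(2) by (simp add: omega_split_def)
  then obtain a where a: "c \<le> a" "s @ [a] \<in> T"
    unfolding infinite_nat_iff_unbounded_le by auto
  then have "\<exists>t\<in>omega_split T. prefix (s @ [a]) t"
    using assms(1) by (simp add: miller_tree_def)
  with a(1) show ?thesis by blast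
qed

text \<open>
  The nodes $u_i$ and $v_i$ are the successive splitting nodes on the two branches. The order of
  the choices matters: $a_i$ is chosen knowing $v_i$, which determines $u_{i+1}$, and then $b_i$ is
  chosen knowing $u_{i+1}$. The inequality $a_0 < b_0$ makes the branches split at the common node
  $u_0 = v_0$.
\<close>

lemma interleaved_nodes:
  assumes "miller_tree T"
  obtains u v :: "nat \<Rightarrow> nat list" and a b :: "nat \<Rightarrow> nat"
  where "u 0 = v 0" and "\<And>i. u i \<in> T" and "\<And>i. v i \<in> T"
    and "\<And>i. prefix (u i @ [a i]) (u (Suc i))" and "\<And>i. prefix (v i @ [b i]) (v (Suc i))"
    and "\<And>i. length (v i) \<le> a i" and "\<And>i. length (u (Suc i)) \<le> b i" and "\<And>i. a i < b i"
proof -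
  obtain r where r: "r \<in> omega_split T"
    using assms unfolding miller_tree_def is_tree_def by blast
  \<comment> \<open>The dependent choice is made over pairs of nodes; starting from an equal pair makes
    the two branches share a stem that ends in a splitting node.\<close>
  define P where "P i p \<longleftrightarrow> fst p \<in> omega_split T \<and> snd p \<in> omega_split T \<and>
      (i = 0 \<longrightarrow> fst p = snd p)" for i :: nat and p :: "nat list \<times> nat list"
  define Q where "Q p p' \<longleftrightarrow> (\<exists>a b. prefix (fst p @ [a]) (fst p') \<and> prefix (snd p @ [b]) (snd p') \<and>
      length (snd p) \<le> a \<and> length (fst p') \<le> b \<and> a < b)" for p p' :: "nat list \<times> nat list"
  have step: "\<exists>p'. P (Suc i) p' \<and> Q p p'" if "P i p" for i p
  proof -
    have nodes: "fst p \<in> omega_split T" "snd p \<in> omega_split T"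
      using \<open>P i p\<close> by (simp_all add: P_def)
    obtain a u' where u': "length (snd p) \<le> a" "u' \<in> omega_split T" "prefix (fst p @ [a]) u'"
      using omega_split_extend[OF assms nodes(1), of "length (snd p)"] by blast
    obtain b v' where v': "length u' + Suc a \<le> b" "v' \<in> omega_split T" "prefix (snd p @ [b]) v'"
      using omega_split_extend[OF assms nodes(2), of "length u' + Suc a"] by blast
    have "P (Suc i) (u', v')" using u' v' by (simp add: P_def)
    moreover have "Q p (u', v')"
      unfolding Q_def using u' v' by (intro exI[of _ a] exI[of _ b]) simp
    ultimately show ?thesis by blast
  qed
  have "P 0 (r, r)" using r by (simp add: P_def)
  then have "\<exists>h. \<forall>i. P i (h i) \<and> Q (h i) (h (Suc i))"
    by (intro dependent_nat_choice[of P "\<lambda>_. Q"]) (blast, rule step)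
  then obtain h where h: "\<And>i. P i (h i)" "\<And>i. Q (h i) (h (Suc i))"
    by blast
  have "\<forall>i. \<exists>a b. prefix (fst (h i) @ [a]) (fst (h (Suc i))) \<and>
      prefix (snd (h i) @ [b]) (snd (h (Suc i))) \<and>
      length (snd (h i)) \<le> a \<and> length (fst (h (Suc i))) \<le> b \<and> a < b"
    using h(2) by (simp add: Q_def)
  then have "\<exists>a b. \<forall>i. prefix (fst (h i) @ [a i]) (fst (h (Suc i))) \<and>
      prefix (snd (h i) @ [b i]) (snd (h (Suc i))) \<and>
      length (snd (h i)) \<le> a i \<and> length (fst (h (Suc i))) \<le> b i \<and> a i < b i"
    by (simp only: choice_iff)
  then obtain a b where ab: "\<forall>i. prefix (fst (h i) @ [a i]) (fst (h (Suc i))) \<and>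
      prefix (snd (h i) @ [b i]) (snd (h (Suc i))) \<and>
      length (snd (h i)) \<le> a i \<and> length (fst (h (Suc i))) \<le> b i \<and> a i < b i"
    by (elim exE)
  show thesis
    by (rule that[of "\<lambda>i. fst (h i)" "\<lambda>i. snd (h i)" a b])
      (use ab h(1) in \<open>auto simp: P_def omega_split_def\<close>)
qed

text \<open>
  Here $p_i$ and $q_i$ are the lengths of the splitting nodes of $x$ and $y$. For
  $q_i \<le> m < q_{i+1}$ the value of $y$ at $q_i$ reaches $p_{i+1}$, where the value of $x$ reaches
  $q_{i+1}$ and so exceeds $m$: the pair is not stalled at $m$. Below $q_0$ there is nothing to
  check, as $x$ and $y$ agree there.
\<close>

lemma interleaved_not_stalled:
  fixes x y :: baire and p q :: "nat \<Rightarrow> nat"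
  assumes agree: "\<And>k. k < q 0 \<Longrightarrow> x k = y k"
    and mono: "strict_mono q"
    and y: "\<And>i. p (Suc i) \<le> y (q i)" and x: "\<And>i. q (Suc i) \<le> x (p (Suc i))"
  shows "(x, y) \<notin> stalled"
proof
  assume "(x, y) \<in> stalled"
  then obtain n m L where nm: "n \<le> m" "x n \<noteq> y n"
    and L: "\<And>j. j \<le> m \<Longrightarrow> y j \<le> L" and m: "\<And>k. k \<le> L \<Longrightarrow> x k \<le> m"
    unfolding stalled_def by blast
  have "q i \<le> m" for i
  proof (induction i)
    case 0
    have "q 0 \<le> n" using agree[of n] nm(2) by (meson not_le)
    then show ?case using nm(1) by simp
  next
    case (Suc i)
    have "p (Suc i) \<le> L" using y[of i] L[OF Suc] by simp
    then show ?case using m x[of i] by (meson order_trans)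
  qed
  moreover have "Suc m \<le> q (Suc m)" using mono by (rule strict_mono_imp_increasing)
  ultimately show False by (meson Suc_n_not_le_n order_trans)
qed

lemma miller_tree_not_stalled_pair:
  assumes "miller_tree T"
  obtains x y where "x \<in> body T" and "y \<in> body T" and "x \<noteq> y" and "(x, y) \<notin> stalled"
proof -
  obtain u v a b where uv: "u 0 = v 0" "\<And>i. u i \<in> T" "\<And>i. v i \<in> T"
    and u: "\<And>i. prefix (u i @ [a i]) (u (Suc i))" and v: "\<And>i. prefix (v i @ [b i]) (v (Suc i))"
    and a: "\<And>i. length (v i) \<le> a i" and b: "\<And>i. length (u (Suc i)) \<le> b i"
    and ab: "\<And>i. a i < b i"
    by (fact interleaved_nodes[OF assms])
  have tree: "is_tree T" using assms by (simp add: miller_tree_def)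
  obtain x where x: "x \<in> body T" "\<And>i k. k < length (u i) \<Longrightarrow> x k = u i ! k"
    by (fact branch_through_chain[of T u, OF tree uv(2) prefix_append_nthD(3)[OF u]])
  obtain y where y: "y \<in> body T" "\<And>i k. k < length (v i) \<Longrightarrow> y k = v i ! k"
    by (fact branch_through_chain[of T v, OF tree uv(3) prefix_append_nthD(3)[OF v]])
  have xa: "x (length (u i)) = a i" for i
    using x(2)[of "length (u i)" "Suc i"] prefix_append_nthD[OF u[of i]] by simp
  have yb: "y (length (v i)) = b i" for i
    using y(2)[of "length (v i)" "Suc i"] prefix_append_nthD[OF v[of i]] by simp
  have "x \<noteq> y" using xa[of 0] yb[of 0] ab[of 0] uv(1) by auto
  moreover have "(x, y) \<notin> stalled"
  proof (rule interleaved_not_stalled[of "\<lambda>i. length (v i)" x y "\<lambda>i. length (u i)"])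
    show "x k = y k" if "k < length (v 0)" for k using that x(2)[of k 0] y(2)[of k 0] uv(1) by simp
    show "strict_mono (\<lambda>i. length (v i))"
      using prefix_append_nthD(1)[OF v] by (simp add: strict_mono_Suc_iff)
  qed (simp_all add: xa yb a b)
  ultimately show thesis using that x(1) y(1) by blast
qed

theorem theorem3:
  shows "\<exists>U :: (baire \<times> baire) set. open U \<and> closure U = UNIV \<and>
    (\<forall>T. miller_tree T \<longrightarrow> \<not> (body T \<times> body T \<subseteq> U \<union> {(x, x) | x. x \<in> UNIV}))"
proof (intro exI[of _ stalled] conjI allI impI open_stalled closure_stalled)
  fix T
  assume "miller_tree T"
  then show "\<not> (body T \<times> body T \<subseteq> stalled \<union> {(x, x) | x. x \<in> UNIV})"
    by (rule miller_tree_not_stalled_pair) auto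
qed

end
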